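(* There is an absolute constant $C>0$ such that the following holds. Let $u,n$ be positive integers, $p_{\mathsf{fail}}\ge 0$ and $\varepsilon^{+}\ge 0$, and let $F$ be a dynamic filter in $F_{\mathsf{dynamic}}(u,n,p_{\mathsf{fail}},\varepsilon^{+})$, i.e., a dynamic filter that is correct with respect to all $(u,n)$-sequences (which may contain duplicate insertions and deletions of nonelements). If (i) $2n\cdot p_{\mathsf{fail}}\le \frac{1}{1+n\varepsilon^{+}}-2^{-n}$, (ii) $\varepsilon^{+}\le 1-\frac1n$, and (iii) $u\ge 2n$, then \[ \mathrm{space}(F)\ \ge\ \frac12\Big(1-\varepsilon^{+}-\frac1n\Big)\log_2\binom{u}{n}-Cn . \]
   Context: Universe $[u]=\{0,1,\dots,u-1\}$; a dataset is a subset of $[u]$. A dynamic filter is a 4-tuple of algorithms $A_{\mathsf{init}},A_{\mathsf{ins}},A_{\mathsf{del}},A_{\mathsf{query}}$ sharing a random string $r$ (drawn, at initialization, from a distribution over strings of bounded length). Its state $M_t$ is a binary string or the special symbol $\mathsf{fail}$. A sequence of operations $\{op_t\}_{t=0}^T$ with $op_0=\mathsf{init}$ defines datasets $S_t$: $\mathsf{init}$ sets $S_t=\emptyset$; $\mathsf{ins}(x_t)$ sets $S_t=S_{t-1}\cup\{x_t\}$; $\mathsf{del}(x_t)$ sets $S_t=S_{t-1}\setminus\{x_t\}$; $\mathsf{query}(x_t)$ sets $S_t=S_{t-1}$. It is a $(u,n)$-sequence if $op_0=\mathsf{init}$, all arguments lie in $[u]$, and $\max_t|S_t|\le n$ (inserting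 a current element, or deleting a non-element, is allowed). Processing: $\mathsf{init}$ draws $r$ and sets $M_t=A_{\mathsf{init}}(r)$; $\mathsf{ins}(x_t)$/$\mathsf{del}(x_t)$ set $M_t=A_{\mathsf{ins}}(r,M_{t-1},x_t)$ / $A_{\mathsf{del}}(r,M_{t-1},x_t)$; $\mathsf{query}(x_t)$ computes $(M_t,b_t)=A_{\mathsf{query}}(r,M_{t-1},x_t)$ with answer bit $b_t$. $F\in F_{\mathsf{dynamic}}(u,n,p_{\mathsf{fail}},\varepsilon^{+})$ means that for every $(u,n)$-sequence: initialization never yields $\mathsf{fail}$; $\mathsf{fail}$ is a sink (if $M_{t-1}=\mathsf{fail}$ and $op_t\ne\mathsf{init}$ then $M_t=\mathsf{fail}$); for an insert/delete, $\Pr_r[M_t=\mathsf{fail}\mid M_{t-1}\neq\mathsf{fail}]\le p_{\mathsf{fail}}$; for a query, $\Pr_r[M_t=\mathsf{fail}\mid M_{t-1}\ne\mathsf{fail}]=0$; completeness: if $op_t=\mathsf{query}(x_t)$ and ($x_t\in S_t$ or $M_{t-1}=\mathsf{fail}$) then $\Pr_r[b_t=1]=1$; soundness: if $op_t=\mathsf{query}(x_t)$ and $x_t\notin S_t$ then $\Pr_r[b_t=1\mid M_{t-1}\ne\mathsf{fail}]\le\varepsilon^{+}$. The input sequence is fixed independently of $r$. $\mathrm{space}(F)$ is the maximum length in bits of $M_t$ over all $(u,n)$-sequences, all $r$ and all $t$ (the random string and temporary memory are not counted). *)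

theory Defs
  imports "HOL-Probability.Probability" "HOL-Library.Extended_Nat"
begin

type_synonym bitstring = "bool list"

text \<open>\<^term>\<open>None\<close> is the special symbol fail.\<close>
type_synonym state = "bitstring option"

datatype (args: 'a) operation = Init | Ins 'a | Del 'a | Query 'a

record dfilter =
  rand :: "bitstring pmf"
  A_init :: "bitstring \<Rightarrow> state"
  A_ins :: "bitstring \<Rightarrow> state \<Rightarrow> nat \<Rightarrow> state"
  A_del :: "bitstring \<Rightarrow> state \<Rightarrow> nat \<Rightarrow> state"
  A_query :: "bitstring \<Rightarrow> state \<Rightarrow> nat \<Rightarrow> state \<times> bool"

fun update :: "'a operation \<Rightarrow> 'a set \<Rightarrow> 'a set" where
  "update Init S = {}"
| "update (Ins x) S = S \<union> {x}"
| "update (Del x) S = S - {x}"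
| "update (Query x) S = S"

text \<open>Throughout, a sequence of operations \<open>op_0, \<dots>, op_T\<close> is a list of length \<open>T + 1\<close>.
  The base cases of \<open>dataset\<close> and \<open>run\<close> below rely on \<open>op_0\<close> being \<^term>\<open>Init\<close>;
  \<^term>\<open>Init\<close> may also occur later in the sequence.\<close>

primrec dataset :: "'a operation list \<Rightarrow> nat \<Rightarrow> 'a set" where
  "dataset ops 0 = {}"
| "dataset ops (Suc t) = update (ops ! Suc t) (dataset ops t)"

definition un_sequence :: "nat \<Rightarrow> nat \<Rightarrow> nat operation list \<Rightarrow> bool" where
  "un_sequence u n ops \<longleftrightarrow>
     ops \<noteq> [] \<and> ops ! 0 = Init \<and>
     (\<forall>a\<in>set ops. args a \<subseteq> {..<u}) \<and>
     (\<forall>t<length ops. card (dataset ops t) \<le> n)"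

fun next_state :: "dfilter \<Rightarrow> bitstring \<Rightarrow> state \<Rightarrow> nat operation \<Rightarrow> state" where
  "next_state F r M Init = A_init F r"
| "next_state F r M (Ins x) = A_ins F r M x"
| "next_state F r M (Del x) = A_del F r M x"
| "next_state F r M (Query x) = fst (A_query F r M x)"

text \<open>\<open>run F ops t\<close> is the joint distribution of the current random string and \<open>M_t\<close>. Every
  \<^term>\<open>Init\<close> draws a fresh random string; all other operations reuse the current one, so that
  \<open>M_t\<close> and the answer to the \<open>t\<close>-th operation are functions of the pair at time \<open>t - 1\<close>.\<close>

primrec run :: "dfilter \<Rightarrow> nat operation list \<Rightarrow> nat \<Rightarrow> (bitstring \<times> state) pmf" where
  "run F ops 0 = map_pmf (\<lambda>r. (r, A_init F r)) (rand F)"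
| "run F ops (Suc t) =
     bind_pmf (run F ops t) (\<lambda>(r, M).
       map_pmf (\<lambda>r'. (r', next_state F r' M (ops ! Suc t)))
         (if ops ! Suc t = Init then rand F else return_pmf r))"

text \<open>\<^const>\<open>cond_prob\<close> is \<open>0\<close> if the condition has probability \<open>0\<close>, so the conditional bounds
  below are void in that case.\<close>

definition dynamic_filter :: "nat \<Rightarrow> nat \<Rightarrow> real \<Rightarrow> real \<Rightarrow> dfilter \<Rightarrow> bool" where
  "dynamic_filter u n pfail eps F \<longleftrightarrow>
     (\<exists>b. \<forall>r\<in>set_pmf (rand F). length r \<le> b) \<and>
     (\<forall>ops. un_sequence u n ops \<longrightarrow>
       (\<forall>t<length ops. ops ! t = Init \<longrightarrow> (\<forall>(r, M)\<in>set_pmf (run F ops t). M \<noteq> None)) \<and>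
       (\<forall>t. Suc t < length ops \<longrightarrow>
         (ops ! Suc t \<noteq> Init \<longrightarrow>
           (\<forall>(r, M)\<in>set_pmf (run F ops t). M = None \<longrightarrow> next_state F r M (ops ! Suc t) = None)) \<and>
         (\<forall>x. ops ! Suc t = Ins x \<or> ops ! Suc t = Del x \<longrightarrow>
           \<P>((r, M) in run F ops t. next_state F r M (ops ! Suc t) = None \<bar> M \<noteq> None) \<le> pfail) \<and>
         (\<forall>x. ops ! Suc t = Query x \<longrightarrow>
           \<P>((r, M) in run F ops t. next_state F r M (ops ! Suc t) = None \<bar> M \<noteq> None) = 0 \<and>
           \<P>((r, M) in run F ops t.
               x \<in> dataset ops (Suc t) \<or> M = None \<longrightarrow> snd (A_query F r M x)) = 1 \<and>
           (x \<notin> dataset ops (Suc t) \<longrightarrow>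
             \<P>((r, M) in run F ops t. snd (A_query F r M x) \<bar> M \<noteq> None) \<le> eps))))"

text \<open>The value is \<open>\<infinity>\<close> if the state lengths are unbounded; fail does not contribute.\<close>

definition filter_space :: "nat \<Rightarrow> nat \<Rightarrow> dfilter \<Rightarrow> enat" where
  "filter_space u n F =
     Sup {enat (length m) | ops t r m.
       un_sequence u n ops \<and> t < length ops \<and> (r, Some m) \<in> set_pmf (run F ops t)}"

end

theory Submission
  imports Defs
begin

text \<open>Insert a set \<open>S\<close> of size \<open>n\<close>, reaching a state \<open>M\<close>, and then delete \<open>S\<close> again, reaching \<open>M'\<close>.
  For a fixed random string, let \<open>T\<close> be any list of \<open>n\<close> deletions leading from \<open>M\<close> to \<open>M'\<close>. Since
  elements of \<open>S\<close> outside \<open>T\<close> may never be rejected, even if \<open>T\<close> contains non-elements, \<open>T\<close> must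
  contain every element of \<open>S\<close> that \<open>M'\<close> rejects. As such a \<open>T\<close> can be found from \<open>M\<close> and \<open>M'\<close> alone,
  these two states determine \<open>S\<close> up to the \<open>n\<close>-bit information \<open>S \<inter> T\<close> and the set of elements of \<open>S\<close>
  still accepted by \<open>M'\<close>. By Markov's inequality and a union bound over the \<open>2 n\<close> possible failures,
  with probability at least \<open>2\<^sup>-\<^sup>n\<close> there are fewer than \<open>1 + n \<epsilon>\<close> of the latter, so for some random
  string a \<open>2\<^sup>-\<^sup>n\<close> fraction of all \<open>S\<close> is encoded this way. The factor \<open>1/2\<close> in the bound is due to
  the use of two states.\<close>

section \<open>Deterministic execution for a fixed random string\<close>

definition exec :: "dfilter \<Rightarrow> bitstring \<Rightarrow> nat operation list \<Rightarrow> state \<Rightarrow> state" where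
  "exec F r os M = fold (\<lambda>a M. next_state F r M a) os M"

lemma exec_append: "exec F r (os @ os') M = exec F r os' (exec F r os M)"
  by (simp add: exec_def)

lemma exec_single [simp]: "exec F r [a] M = next_state F r M a"
  by (simp add: exec_def)

lemma dataset_Cons:
  "t \<le> length os \<Longrightarrow> dataset (a # os) t = fold update (take t os) {}"
  by (induction t) (auto simp: take_Suc_conv_app_nth)

text \<open>Without a later \<open>Init\<close> the random string is drawn only once, so every
  probability about a run becomes one about \<open>r\<close> drawn from
  \<open>rand F\<close>.\<close>

lemma run_no_reinit:
  assumes "Init \<notin> set os" "t \<le> length os"
  shows "run F (Init # os) t = map_pmf (\<lambda>r. (r, exec F r (take t os) (A_init F r))) (rand F)"
  using assms(2)
proof (induction t)
  case 0
  then show ?case by (simp add: exec_def)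
next
  case (Suc t)
  then have "os ! t \<noteq> Init"
    using assms(1) by (metis Suc_le_eq nth_mem)
  with Suc show ?case
    by (simp add: bind_map_pmf map_pmf_def[symmetric] take_Suc_conv_app_nth exec_append)
qed

lemma fold_update_Ins: "fold update (map Ins xs) S = S \<union> set xs"
  by (induction xs arbitrary: S) auto

lemma fold_update_Del: "fold update (map Del ys) S = S - set ys"
  by (induction ys arbitrary: S) auto

lemma fold_update_Query: "fold update (map Query zs) S = S"
  by (induction zs arbitrary: S) auto

text \<open>The list \<open>ys\<close> is unrelated to \<open>xs\<close>: deleting non-elements is
  allowed, and the dataset never leaves \<open>set xs\<close>. This freedom admits the deletion list
  recovered from two states.\<close>

lemma un_sequence_ins_del_query:
  assumes "length xs \<le> n" "set xs \<union> set ys \<union> set zs \<subseteq> {..<u}"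
  shows "un_sequence u n (Init # map Ins xs @ map Del ys @ map Query zs)"
proof -
  have "dataset (Init # map Ins xs @ map Del ys @ map Query zs) t \<subseteq> set xs"
    if "t < length (Init # map Ins xs @ map Del ys @ map Query zs)" for t
    using that set_take_subset[of t xs]
    by (subst dataset_Cons)
      (auto simp: take_map fold_update_Ins fold_update_Del fold_update_Query)
  moreover have "card (set xs) \<le> n"
    using assms(1) card_length[of xs] by linarith
  ultimately have "card (dataset (Init # map Ins xs @ map Del ys @ map Query zs) t) \<le> n"
    if "t < length (Init # map Ins xs @ map Del ys @ map Query zs)" for t
    using that card_mono[of "set xs"] by (meson List.finite_set le_trans)
  then show ?thesis
    using assms(2) unfolding un_sequence_def by (auto simp del: dataset.simps)
qed

text \<open>The joint probability is the conditional one times a factor at most 1. If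
  \<open>Q\<close> is null, where \<open>cond_prob\<close> is 0 by convention, the joint event is
  null as well.\<close>

lemma prob_le_of_cond_prob_le:
  assumes "\<P>(x in measure_pmf p. P x \<bar> Q x) \<le> c" "0 \<le> c"
  shows "measure_pmf.prob p {x. P x \<and> Q x} \<le> c"
proof (cases "measure_pmf.prob p {x. Q x} = 0")
  case True
  have "measure_pmf.prob p {x. P x \<and> Q x} \<le> measure_pmf.prob p {x. Q x}"
    by (intro measure_pmf.finite_measure_mono) auto
  then show ?thesis using True assms(2) by simp
next
  case False
  then have pos: "measure_pmf.prob p {x. Q x} > 0"
    by (simp add: zero_less_measure_iff)
  have "measure_pmf.prob p {x. P x \<and> Q x} \<le> c * measure_pmf.prob p {x. Q x}"
    using assms(1) pos by (simp add: cond_prob_def field_simps)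
  also have "\<dots> \<le> c * 1"
    using assms(2) by (intro mult_left_mono) auto
  finally show ?thesis by simp
qed

lemma un_sequence_appendD:
  assumes "un_sequence u n (Init # os @ os')"
  shows "un_sequence u n (Init # os)"
proof -
  have "card (dataset (Init # os) t) \<le> n" if "t < length (Init # os)" for t
  proof -
    have "dataset (Init # os @ os') t = dataset (Init # os) t"
      using that by (simp add: dataset_Cons)
    then show ?thesis
      using assms that unfolding un_sequence_def by (metis add_Suc append_Cons length_append
          length_Cons trans_less_add1)
  qed
  then show ?thesis
    using assms unfolding un_sequence_def by auto
qed

lemma length_le_filter_space:
  assumes "un_sequence u n (Init # os)" "Init \<notin> set os"
    and "r \<in> set_pmf (rand F)" "exec F r os (A_init F r) = Some m"
  shows "enat (length m) \<le> filter_space u n F"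
proof -
  have "(r, Some m) \<in> set_pmf (run F (Init # os) (length os))"
    using assms(3,4) by (force simp: run_no_reinit[OF assms(2)])
  then show ?thesis
    unfolding filter_space_def using assms(1)
    by (intro Sup_upper CollectI exI[of _ m] exI[of _ "Init # os"] exI[of _ "length os"] exI[of _ r])
      auto
qed

section \<open>Guarantees of the filter along one operation sequence\<close>

context
  fixes u n :: nat and pfail eps :: real and F :: dfilter
  assumes filter: "dynamic_filter u n pfail eps F"
begin

context
  fixes os :: "nat operation list" and a :: "nat operation"
  assumes seq: "un_sequence u n (Init # os @ [a])"
    and no_init: "Init \<notin> set os"
begin

lemma run_before_last:
  "run F (Init # os @ [a]) (length os) =
     map_pmf (\<lambda>r. (r, exec F r os (A_init F r))) (rand F)"
proof -
  have "run F (Init # os @ [a]) t = run F (Init # os) t" if "t \<le> length os" for t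
    using that by (induction t) (auto simp: nth_append)
  then show ?thesis
    using run_no_reinit[OF no_init, of "length os" F] by simp
qed

lemma dataset_last:
  "dataset (Init # os @ [a]) (Suc (length os)) = update a (fold update os {})"
  by (subst dataset_Cons) auto

text \<open>Extracting the guarantees for the final operation suffices, since prefixes of admissible
  sequences are admissible and earlier operations are final in some prefix.\<close>

lemma filter_last:
  defines "p \<equiv> map_pmf (\<lambda>r. (r, exec F r os (A_init F r))) (rand F)"
  shows "a \<noteq> Init \<Longrightarrow> (r, None) \<in> set_pmf p \<Longrightarrow> next_state F r None a = None"
    and "a = Ins x \<or> a = Del x \<Longrightarrow>
      \<P>((r, M) in p. next_state F r M a = None \<bar> M \<noteq> None) \<le> pfail"
    and "a = Query x \<Longrightarrow>
      \<P>((r, M) in p. x \<in> update a (fold update os {}) \<or> M = None \<longrightarrow> snd (A_query F r M x)) = 1"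
    and "a = Query x \<Longrightarrow> x \<notin> update a (fold update os {}) \<Longrightarrow>
      \<P>((r, M) in p. snd (A_query F r M x) \<bar> M \<noteq> None) \<le> eps"
proof -
  have last: "(Init # os @ [a]) ! Suc (length os) = a" "Suc (length os) < length (Init # os @ [a])"
    by simp_all
  note step = filter[unfolded dynamic_filter_def, THEN conjunct2, THEN spec, THEN mp, OF seq,
    THEN conjunct2, THEN spec, THEN mp, OF last(2),
    unfolded last(1) run_before_last dataset_last, folded p_def]
  show "a \<noteq> Init \<Longrightarrow> (r, None) \<in> set_pmf p \<Longrightarrow> next_state F r None a = None"
    using step by blast
  show "a = Ins x \<or> a = Del x \<Longrightarrow>
      \<P>((r, M) in p. next_state F r M a = None \<bar> M \<noteq> None) \<le> pfail"
    using step by blast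
  show "a = Query x \<Longrightarrow>
      \<P>((r, M) in p. x \<in> update a (fold update os {}) \<or> M = None \<longrightarrow> snd (A_query F r M x)) = 1"
    using step by blast
  show "a = Query x \<Longrightarrow> x \<notin> update a (fold update os {}) \<Longrightarrow>
      \<P>((r, M) in p. snd (A_query F r M x) \<bar> M \<noteq> None) \<le> eps"
    using step by blast
qed

lemma fail_sink:
  assumes "a \<noteq> Init" "r \<in> set_pmf (rand F)" "exec F r os (A_init F r) = None"
  shows "exec F r (os @ [a]) (A_init F r) = None"
  using filter_last(1)[of r] assms by (force simp: exec_append)

lemma prob_fail_step:
  assumes "a = Ins x \<or> a = Del x" "0 \<le> pfail"
  shows "measure_pmf.prob (rand F)
    {r. exec F r (os @ [a]) (A_init F r) = None \<and> exec F r os (A_init F r) \<noteq> None} \<le> pfail"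
proof -
  have "\<P>((r, M) in map_pmf (\<lambda>r. (r, exec F r os (A_init F r))) (rand F).
      next_state F r M a = None \<bar> M \<noteq> None) \<le> pfail"
    using filter_last(2) assms(1) by blast
  from prob_le_of_cond_prob_le[OF this[unfolded case_prod_unfold] assms(2)] show ?thesis
    by (simp add: exec_append vimage_def)
qed

text \<open>An event of probability 1 under a discrete distribution contains the whole support, so
  the guarantee holds for each possible \<open>r\<close> separately.\<close>

lemma completeness:
  assumes "a = Query x" "x \<in> fold update os {}" "r \<in> set_pmf (rand F)"
  shows "snd (A_query F r (exec F r os (A_init F r)) x)"
proof -
  let ?p = "map_pmf (\<lambda>r. (r, exec F r os (A_init F r))) (rand F)"
  have "\<P>((r, M) in ?p. snd (A_query F r M x)) = 1"
    using filter_last(3)[OF assms(1)] assms(1,2) by simp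
  then have "measure_pmf.prob (rand F) {r. snd (A_query F r (exec F r os (A_init F r)) x)} = 1"
    by (simp add: vimage_def)
  then show ?thesis
    using assms(3) measure_pmf.prob_eq_1[of "{r. snd (A_query F r (exec F r os (A_init F r)) x)}" "rand F"]
    by (auto simp: AE_measure_pmf_iff)
qed

lemma prob_false_positive:
  assumes "a = Query x" "x \<notin> fold update os {}" "0 \<le> eps"
  shows "measure_pmf.prob (rand F)
    {r. snd (A_query F r (exec F r os (A_init F r)) x) \<and> exec F r os (A_init F r) \<noteq> None} \<le> eps"
proof -
  have "\<P>((r, M) in map_pmf (\<lambda>r. (r, exec F r os (A_init F r))) (rand F).
      snd (A_query F r M x) \<bar> M \<noteq> None) \<le> eps"
    using filter_last(4)[OF assms(1)] assms(1,2) by simp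
  from prob_le_of_cond_prob_le[OF this[unfolded case_prod_unfold] assms(3)] show ?thesis
    by (simp add: vimage_def)
qed

end

text \<open>Used in contrapositive form: a non-fail final state guarantees a non-fail state in the
  middle of the run.\<close>

lemma fail_persists:
  assumes "un_sequence u n (Init # os @ os')" "Init \<notin> set (os @ os')"
    and "r \<in> set_pmf (rand F)" "exec F r os (A_init F r) = None"
  shows "exec F r (os @ os') (A_init F r) = None"
  using assms(1,2)
proof (induction os' rule: rev_induct)
  case Nil
  then show ?case using assms(4) by simp
next
  case (snoc a os')
  then have "exec F r (os @ os') (A_init F r) = None"
    using un_sequence_appendD[of u n "os @ os'" "[a]"] by auto
  then show ?case
    using fail_sink[of "os @ os'" a r] snoc.prems assms(3) by auto
qed

text \<open>Union bound over the step at which fail first appears; initialization never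
  fails.\<close>

lemma prob_fail_le:
  assumes "un_sequence u n (Init # os)" "set os \<subseteq> range Ins \<union> range Del" "0 \<le> pfail"
  shows "measure_pmf.prob (rand F) {r. exec F r os (A_init F r) = None} \<le> real (length os) * pfail"
  using assms(1,2)
proof (induction os rule: rev_induct)
  case Nil
  then have "\<forall>(r, M) \<in> set_pmf (run F [Init] 0). M \<noteq> None"
    using filter unfolding dynamic_filter_def by force
  then have "measure_pmf.prob (rand F) {r. A_init F r = None} = 0"
    by (auto simp: measure_pmf_zero_iff)
  then show ?case by (simp add: exec_def)
next
  case (snoc a os)
  let ?st = "\<lambda>os r. exec F r os (A_init F r)"
  have IH: "measure_pmf.prob (rand F) {r. ?st os r = None} \<le> real (length os) * pfail"
    using snoc un_sequence_appendD[of u n os "[a]"] by auto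
  obtain x where x: "a = Ins x \<or> a = Del x"
    using snoc.prems by auto
  have "Init \<notin> set os"
    using snoc.prems by auto
  then have step: "measure_pmf.prob (rand F) {r. ?st (os @ [a]) r = None \<and> ?st os r \<noteq> None} \<le> pfail"
    using prob_fail_step[of os a x] snoc.prems x assms(3) by auto
  have "measure_pmf.prob (rand F) {r. ?st (os @ [a]) r = None}
      \<le> measure_pmf.prob (rand F)
          ({r. ?st os r = None} \<union> {r. ?st (os @ [a]) r = None \<and> ?st os r \<noteq> None})"
    by (intro measure_pmf.finite_measure_mono) auto
  also have "\<dots> \<le> real (length os) * pfail + pfail"
    using measure_Un_le[of "{r. ?st os r = None}" "measure_pmf (rand F)"
        "{r. ?st (os @ [a]) r = None \<and> ?st os r \<noteq> None}"]
      IH step by simp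
  finally show ?case by (simp add: algebra_simps)
qed

end

section \<open>Sets that are likely to be encodable\<close>

definition ins_del_state :: "dfilter \<Rightarrow> nat set \<Rightarrow> bitstring \<Rightarrow> state" where
  "ins_del_state F S r =
     exec F r (map Ins (sorted_list_of_set S) @ map Del (sorted_list_of_set S)) (A_init F r)"

definition accepted :: "dfilter \<Rightarrow> nat set \<Rightarrow> bitstring \<Rightarrow> nat set" where
  "accepted F S r = {x \<in> S. snd (A_query F r (ins_del_state F S r) x)}"

definition good :: "real \<Rightarrow> dfilter \<Rightarrow> bitstring \<Rightarrow> nat set \<Rightarrow> bool" where
  "good b F r S \<longleftrightarrow> ins_del_state F S r \<noteq> None \<and> real (card (accepted F S r)) < b"

text \<open>Linearity of expectation, used twice: to count the false positives in one set
  \<open>S\<close>, and to count the good sets for a random \<open>r\<close>.\<close>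

lemma expectation_card:
  assumes "finite I"
  shows "measure_pmf.expectation p (\<lambda>r. real (card {i \<in> I. P i r})) =
    (\<Sum>i\<in>I. measure_pmf.prob p {r. P i r})"
    and "integrable (measure_pmf p) (\<lambda>r. real (card {i \<in> I. P i r}))"
proof -
  have card: "real (card {i \<in> I. P i r}) = (\<Sum>i\<in>I. indicator {r. P i r} r)" for r
    using assms by (simp add: indicator_def sum.If_cases Int_def)
  have int: "integrable (measure_pmf p) (indicator {r. P i r} :: _ \<Rightarrow> real)" for i
    by (auto intro!: measure_pmf.integrable_const_bound[where B = 1] simp: indicator_def)
  show "measure_pmf.expectation p (\<lambda>r. real (card {i \<in> I. P i r})) =
      (\<Sum>i\<in>I. measure_pmf.prob p {r. P i r})"
    unfolding card using int by (subst Bochner_Integration.integral_sum) auto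
  show "integrable (measure_pmf p) (\<lambda>r. real (card {i \<in> I. P i r}))"
    unfolding card using int by auto
qed

text \<open>After the deletions the dataset is empty, so acceptance of any \<open>x\<close> in
  \<open>S\<close> is a false positive. Markov's inequality at threshold \<open>1 + n * eps\<close>
  loses \<open>n * eps / (1 + n * eps)\<close>, and the \<open>2 * n\<close> updates lose
  \<open>2 * n * pfail\<close>.\<close>

lemma prob_good_ge:
  assumes filter: "dynamic_filter u n pfail eps F"
    and nonneg: "0 \<le> pfail" "0 \<le> eps"
    and S: "S \<subseteq> {..<u}" "card S = n"
  shows "1 / (1 + real n * eps) - 2 * real n * pfail
    \<le> measure_pmf.prob (rand F) {r. good (1 + real n * eps) F r S}"
proof -
  let ?b = "1 + real n * eps" and ?P = "measure_pmf.prob (rand F)"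
  let ?xs = "sorted_list_of_set S"
  let ?os = "map Ins ?xs @ map Del ?xs"
  \<comment> \<open>Soundness only controls acceptance by a non-fail state. Outside the fail event,
    which is bounded separately, \<open>?X\<close> is the size of \<open>accepted\<close>.\<close>
  let ?A = "\<lambda>x. {r. snd (A_query F r (ins_del_state F S r) x) \<and> ins_del_state F S r \<noteq> None}"
  let ?X = "\<lambda>r. real (card {x \<in> S. r \<in> ?A x})"
  have b: "0 < ?b"
    using nonneg by (simp add: add_pos_nonneg)
  have fin: "finite S"
    using S(1) finite_subset by blast
  have seq: "un_sequence u n (Init # ?os @ map Query zs)" if "set zs \<subseteq> {..<u}" for zs
    using un_sequence_ins_del_query[of ?xs n ?xs zs u] S fin that by simp
  have no_init: "Init \<notin> set ?os"
    by auto
  have empty: "fold update ?os {} = {}"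
    by (simp add: fold_update_Ins fold_update_Del)
  have fail: "?P {r. ins_del_state F S r = None} \<le> 2 * real n * pfail"
    using prob_fail_le[OF filter _ _ nonneg(1), of ?os] seq[of "[]"] S
    by (auto simp: ins_del_state_def)
  have "?P (?A x) \<le> eps" if "x \<in> S" for x
    using prob_false_positive[OF filter _ no_init, of "Query x" x] seq[of "[x]"] that S nonneg(2) empty
    by (auto simp: ins_del_state_def)
  then have mean: "measure_pmf.expectation (rand F) ?X \<le> real n * eps"
    using sum_bounded_above[of S "\<lambda>x. ?P (?A x)" eps] S fin by (simp add: expectation_card)
  have "?P {r. ?X r \<ge> ?b} \<le> measure_pmf.expectation (rand F) ?X / ?b"
    using integral_Markov_inequality_measure[of "rand F" ?X UNIV ?b]
      expectation_card(2)[OF fin, of "rand F" "\<lambda>x r. r \<in> ?A x"] b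
    by simp
  also have "\<dots> \<le> real n * eps / ?b"
    using mean b by (simp add: divide_right_mono)
  finally have markov: "?P {r. ?X r \<ge> ?b} \<le> real n * eps / ?b" .
  have "1 = ?P UNIV"
    by simp
  also have "\<dots> \<le> ?P ({r. good ?b F r S} \<union> ({r. ins_del_state F S r = None} \<union> {r. ?X r \<ge> ?b}))"
    by (intro measure_pmf.finite_measure_mono) (auto simp: good_def accepted_def not_less)
  also have "\<dots> \<le> ?P {r. good ?b F r S} + (?P {r. ins_del_state F S r = None} + ?P {r. ?X r \<ge> ?b})"
    by (intro order_trans[OF measure_Un_le] add_mono measure_Un_le) auto
  finally have "1 - real n * eps / ?b - 2 * real n * pfail \<le> ?P {r. good ?b F r S}"
    using fail markov by linarith
  moreover have "1 - real n * eps / ?b = 1 / ?b"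
    using b by (simp add: field_simps)
  ultimately show ?thesis by simp
qed

section \<open>Encoding good sets by two states\<close>

text \<open>The choice \<open>T m m'\<close> depends on \<open>r\<close> and the two states but not
  on \<open>S\<close>. Hence \<open>S\<close> is recovered from \<open>m\<close>, \<open>m'\<close>,
  its part \<open>A\<close> inside \<open>T m m'\<close>, and the few remaining elements
  \<open>B\<close>.\<close>

lemma decode_good:
  assumes filter: "dynamic_filter u n pfail eps F"
    and r: "r \<in> set_pmf (rand F)"
    and S: "S \<subseteq> {..<u}" "card S = n" and good: "good b F r S"
    and space: "filter_space u n F = enat s"
    and T: "\<And>m m'. T m m' = (SOME ys. set ys \<subseteq> {..<u} \<and> length ys = n \<and>
      exec F r (map Del ys) (Some m) = Some m')"
  obtains m m' A B where "length m \<le> s" "length m' \<le> s" "set (T m m') \<subseteq> {..<u}"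
    "length (T m m') = n" "A \<subseteq> set (T m m')" "B \<subseteq> {..<u}" "real (card B) < b" "S = A \<union> B"
proof -
  let ?xs = "sorted_list_of_set S"
  have fin: "finite S"
    using S(1) finite_subset by blast
  have seq: "un_sequence u n (Init # map Ins ?xs @ map Del ys @ map Query zs)"
    if "set ys \<union> set zs \<subseteq> {..<u}" for ys zs
    using un_sequence_ins_del_query[of ?xs n ys zs u] S fin that by simp
  have seq_ins: "un_sequence u n (Init # map Ins ?xs)"
    using seq[of "[]" "[]"] by simp
  have seq_del: "un_sequence u n (Init # map Ins ?xs @ map Del ?xs)"
    using seq[of ?xs "[]"] S fin by simp
  obtain m' where m': "exec F r (map Ins ?xs @ map Del ?xs) (A_init F r) = Some m'"
    using good by (auto simp: good_def ins_del_state_def)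
  have "exec F r (map Ins ?xs) (A_init F r) \<noteq> None"
    using fail_persists[OF filter seq_del _ r] m' by auto
  then obtain m where m: "exec F r (map Ins ?xs) (A_init F r) = Some m"
    by auto
  have len: "length m \<le> s" "length m' \<le> s"
    using length_le_filter_space[OF seq_ins _ r m] length_le_filter_space[OF seq_del _ r m'] space
    by auto
  have "exec F r (map Del ?xs) (Some m) = Some m'"
    using m m' by (simp add: exec_append)
  \<comment> \<open>The listing of \<open>S\<close> itself is a witness, so the \<open>SOME\<close>
    in \<open>T\<close> meets its specification.\<close>
  then have ex: "set ?xs \<subseteq> {..<u} \<and> length ?xs = n \<and> exec F r (map Del ?xs) (Some m) = Some m'"
    using S fin by simp
  have tau: "set (T m m') \<subseteq> {..<u} \<and> length (T m m') = n \<and>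
      exec F r (map Del (T m m')) (Some m) = Some m'"
    unfolding T by (rule someI[where P = "\<lambda>ys. set ys \<subseteq> {..<u} \<and> length ys = n \<and>
        exec F r (map Del ys) (Some m) = Some m'", OF ex])
  \<comment> \<open>Deleting \<open>T m m'\<close> instead of \<open>S\<close> also ends in
    \<open>m'\<close>, but leaves \<open>x\<close> in the dataset. Completeness makes
    \<open>m'\<close> accept \<open>x\<close>, although \<open>x\<close> is absent after deleting
    \<open>S\<close>.\<close>
  have "x \<in> accepted F S r" if x: "x \<in> S - set (T m m')" for x
  proof -
    have "un_sequence u n (Init # (map Ins ?xs @ map Del (T m m')) @ [Query x])"
      using seq[of "T m m'" "[x]"] tau x S by auto
    moreover have "Init \<notin> set (map Ins ?xs @ map Del (T m m'))"
      by auto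
    moreover have "x \<in> fold update (map Ins ?xs @ map Del (T m m')) {}"
      using x fin by (simp add: fold_update_Ins fold_update_Del)
    ultimately have "snd (A_query F r
        (exec F r (map Ins ?xs @ map Del (T m m')) (A_init F r)) x)"
      using completeness[OF filter _ _ refl _ r] by blast
    then show ?thesis
      using x tau m m' by (simp add: accepted_def ins_del_state_def exec_append)
  qed
  then have "card (S - set (T m m')) \<le> card (accepted F S r)"
    using fin by (intro card_mono) (auto simp: accepted_def)
  then have "real (card (S - set (T m m'))) < b"
    using good by (simp add: good_def)
  then show ?thesis
    using that[of m m' "S \<inter> set (T m m')" "S - set (T m m')"] len tau S by auto
qed

lemma card_bool_lists_le:
  "finite {m :: bool list. length m \<le> s}" "card {m :: bool list. length m \<le> s} \<le> 2 ^ Suc s"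
proof -
  have eq: "{m :: bool list. length m \<le> s} = {m. set m \<subseteq> UNIV \<and> length m \<le> s}"
    by simp
  show "finite {m :: bool list. length m \<le> s}"
    unfolding eq by (rule finite_lists_length_le) simp
  have "card {m :: bool list. length m \<le> s} = (\<Sum>i\<le>s. 2 ^ i)"
    unfolding eq by (subst card_lists_length_le) (auto simp: card_UNIV_bool)
  also have "\<dots> \<le> 2 ^ Suc s"
    by (induction s) auto
  finally show "card {m :: bool list. length m \<le> s} \<le> 2 ^ Suc s" .
qed

text \<open>The codes consist of two states, a subset of at most \<open>n\<close> chosen elements,
  and a small set; their decodings cover all good sets.\<close>

lemma card_good_le:
  assumes filter: "dynamic_filter u n pfail eps F"
    and r: "r \<in> set_pmf (rand F)"
    and space: "filter_space u n F = enat s"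
  shows "card {S. S \<subseteq> {..<u} \<and> card S = n \<and> good b F r S}
    \<le> (2 ^ Suc s)\<^sup>2 * 2 ^ n * card {B. B \<subseteq> {..<u} \<and> real (card B) < b}"
proof -
  define T where "T m m' = (SOME ys. set ys \<subseteq> {..<u} \<and> length ys = n \<and>
      exec F r (map Del ys) (Some m) = Some m')" for m m'
  \<comment> \<open>If no suitable deletion list exists, \<open>SOME\<close> may return a list of
    any length; the default \<open>{}\<close> keeps the size at most \<open>n\<close> for every
    pair.\<close>
  define Tc where "Tc = (\<lambda>(m, m'). if length (T m m') = n then set (T m m') else {})"
  define L where "L = {m :: bool list. length m \<le> s}"
  define Bs where "Bs = {B. B \<subseteq> {..<u} \<and> real (card B) < b}"
  let ?D = "(SIGMA p : L \<times> L. Pow (Tc p)) \<times> Bs"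
  have Tc: "finite (Tc p)" "card (Tc p) \<le> n" for p
    using card_length[of "T (fst p) (snd p)"] by (auto simp: Tc_def case_prod_unfold)
  have L: "finite L" "card L \<le> 2 ^ Suc s"
    unfolding L_def by (rule card_bool_lists_le)+
  have finB: "finite Bs"
    unfolding Bs_def by (rule finite_subset[of _ "Pow {..<u}"]) auto
  have finD: "finite ?D"
    using Tc(1) finB L(1) by simp
  have "{S. S \<subseteq> {..<u} \<and> card S = n \<and> good b F r S} \<subseteq> (\<lambda>((p, A), B). A \<union> B) ` ?D"
  proof
    fix S assume "S \<in> {S. S \<subseteq> {..<u} \<and> card S = n \<and> good b F r S}"
    then have "S \<subseteq> {..<u}" "card S = n" "good b F r S"
      by simp_all
    then obtain m m' A B where "length m \<le> s" "length m' \<le> s" "set (T m m') \<subseteq> {..<u}"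
      "length (T m m') = n" "A \<subseteq> set (T m m')" "B \<subseteq> {..<u}" "real (card B) < b"
      and S: "S = A \<union> B"
      by (rule decode_good[OF filter r _ _ _ space T_def])
    then have "(((m, m'), A), B) \<in> ?D"
      by (simp add: Tc_def L_def Bs_def)
    then show "S \<in> (\<lambda>((p, A), B). A \<union> B) ` ?D"
      unfolding S by (rule rev_image_eqI) simp
  qed
  then have "card {S. S \<subseteq> {..<u} \<and> card S = n \<and> good b F r S} \<le> card ?D"
    using finD by (rule surj_card_le[rotated])
  also have "\<dots> = (\<Sum>p\<in>L \<times> L. 2 ^ card (Tc p)) * card Bs"
    using L(1) Tc(1) by (simp add: card_cartesian_product card_Pow)
  also have "\<dots> \<le> (\<Sum>p\<in>L \<times> L. 2 ^ n) * card Bs"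
    using Tc(2) by (intro mult_right_mono sum_mono power_increasing) simp_all
  also have "\<dots> = (card L)\<^sup>2 * 2 ^ n * card Bs"
    by (simp add: card_cartesian_product power2_eq_square)
  also have "\<dots> \<le> (2 ^ Suc s)\<^sup>2 * 2 ^ n * card Bs"
    using L(2) by (intro mult_right_mono power_mono) simp_all
  finally show ?thesis
    unfolding Bs_def .
qed

section \<open>Counting small subsets\<close>

lemma sum_power_div_fact_le_exp:
  fixes x :: real
  assumes "0 \<le> x" "finite K"
  shows "(\<Sum>k\<in>K. x ^ k / fact k) \<le> exp x"
proof -
  have "(\<Sum>k\<in>K. x ^ k / fact k) \<le> (\<Sum>k. x ^ k / fact k)"
    using assms summable_exp[of x] by (intro sum_le_suminf) (auto simp: field_simps)
  then show ?thesis
    by (simp add: exp_def field_simps scaleR_conv_of_real)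
qed

text \<open>For \<open>k < n * d\<close>, \<open>u choose k\<close> is at most
  \<open>u ^ k / fact k = (u / n) ^ k * (n ^ k / fact k)\<close>. The first factor is at most
  \<open>(u choose n) powr d\<close> because \<open>(u / n) ^ n \<le> u choose n\<close>; the second
  factors sum to at most \<open>exp n\<close>.\<close>

lemma card_small_subsets_le:
  assumes "0 < n" "n \<le> u" "0 \<le> d" "real n * d \<le> real n"
  shows "real (card {B. B \<subseteq> {..<u} \<and> real (card B) < real n * d})
    \<le> exp (real n) * real (u choose n) powr d"
proof -
  let ?K = "{k. real k < real n * d}" and ?q = "real u / real n"
  have finK: "finite ?K"
    using assms(4) by (intro finite_subset[of ?K "{..<n}"]) auto
  have q: "1 \<le> ?q"
    using assms by simp
  have "?q ^ n \<le> real (u choose n)"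
    using binomial_ge_n_over_k_pow_k[of n u, where 'a = real] assms(2) by simp
  then have base: "?q powr (real n * d) \<le> real (u choose n) powr d"
    using q assms(1,3) by (simp add: powr_powr[symmetric] powr_realpow powr_mono2)
  have summand: "real (u choose k) \<le> real (u choose n) powr d * (real n ^ k / fact k)" if "k \<in> ?K" for k
  proof -
    have "(u choose k) * fact k \<le> u ^ k"
      by (rule binomial_fact_pow)
    then have "real (u choose k) * fact k \<le> real u ^ k"
      by (metis of_nat_fact of_nat_le_iff of_nat_mult of_nat_power)
    then have "real (u choose k) \<le> ?q ^ k * (real n ^ k / fact k)"
      using assms(1) by (simp add: power_divide field_simps)
    moreover have "?q ^ k \<le> ?q powr (real n * d)"
      using that q by (subst powr_realpow[symmetric]) (auto intro: powr_mono)
    ultimately have "real (u choose k) \<le> ?q ^ k * (real n ^ k / fact k)"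
      "?q ^ k \<le> real (u choose n) powr d"
      using base by linarith+
    then show ?thesis
      by (meson divide_nonneg_pos fact_gt_zero mult_right_mono of_nat_0_le_iff order_trans
          zero_le_power)
  qed
  have "card {B. B \<subseteq> {..<u} \<and> real (card B) < real n * d} =
      card (\<Union>k\<in>?K. {B. B \<subseteq> {..<u} \<and> card B = k})"
    by (intro arg_cong[of _ _ card]) auto
  also have "\<dots> = (\<Sum>k\<in>?K. card {B. B \<subseteq> {..<u} \<and> card B = k})"
    using finK by (intro card_UN_disjoint) (auto intro: finite_subset[of _ "Pow {..<u}"])
  also have "\<dots> = (\<Sum>k\<in>?K. u choose k)"
    by (simp add: n_subsets)
  finally have "real (card {B. B \<subseteq> {..<u} \<and> real (card B) < real n * d}) = (\<Sum>k\<in>?K. real (u choose k))"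
    by simp
  also have "\<dots> \<le> real (u choose n) powr d * (\<Sum>k\<in>?K. real n ^ k / fact k)"
    unfolding sum_distrib_left by (intro sum_mono summand)
  also have "\<dots> \<le> real (u choose n) powr d * exp (real n)"
    by (intro mult_left_mono sum_power_div_fact_le_exp finK) auto
  finally show ?thesis by (simp add: mult.commute)
qed

section \<open>Averaging over random strings and the final bound\<close>

lemma binomial_le_space:
  assumes filter: "dynamic_filter u n pfail eps F"
    and nonneg: "0 \<le> pfail" "0 \<le> eps"
    and prob: "2 powr - real n \<le> 1 / (1 + real n * eps) - 2 * real n * pfail"
    and eps: "eps \<le> 1 - 1 / real n" and "0 < n" "n \<le> u"
    and space: "filter_space u n F = enat s"
  shows "2 powr - real n * real (u choose n) \<le>
    (2 ^ Suc s)\<^sup>2 * 2 ^ n * (exp (real n) * real (u choose n) powr (eps + 1 / real n))"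
proof -
  let ?b = "1 + real n * eps"
  let ?I = "{S. S \<subseteq> {..<u} \<and> card S = n}"
  let ?N = "\<lambda>r. real (card {S \<in> ?I. good ?b F r S})"
  have fin: "finite ?I"
    by (rule finite_subset[of _ "Pow {..<u}"]) auto
  have "2 powr - real n * real (u choose n) \<le>
      (\<Sum>S\<in>?I. measure_pmf.prob (rand F) {r. good ?b F r S})"
    using sum_bounded_below[of ?I "2 powr - real n" "\<lambda>S. measure_pmf.prob (rand F) {r. good ?b F r S}"]
      order_trans[OF prob prob_good_ge[OF filter nonneg]]
    by (simp add: n_subsets mult.commute)
  also have "\<dots> = measure_pmf.expectation (rand F) ?N"
    by (rule expectation_card(1)[OF fin, symmetric])
  finally have mean: "2 powr - real n * real (u choose n) \<le> measure_pmf.expectation (rand F) ?N" .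
  \<comment> \<open>Some string attains at least the mean. It must lie in the support, where the
    encoding is valid.\<close>
  have "\<exists>r\<in>set_pmf (rand F). 2 powr - real n * real (u choose n) \<le> ?N r"
  proof (rule ccontr)
    assume "\<not> ?thesis"
    then have "AE r in rand F. ?N r < 2 powr - real n * real (u choose n)"
      by (auto simp: AE_measure_pmf_iff not_le)
    from measure_pmf.expectation_less[OF expectation_card(2)[OF fin] this] mean show False
      by simp
  qed
  then obtain r where r: "r \<in> set_pmf (rand F)"
    and N: "2 powr - real n * real (u choose n) \<le> ?N r"
    by blast
  \<comment> \<open>This rewrites the Markov threshold as \<open>n * d\<close> with
    \<open>d = eps + 1 / n\<close>; the hypothesis on \<open>eps\<close> says exactly
    \<open>d \<le> 1\<close>.\<close>
  have b: "?b = real n * (eps + 1 / real n)"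
    using \<open>0 < n\<close> by (simp add: field_simps)
  have "?N r \<le> real ((2 ^ Suc s)\<^sup>2 * 2 ^ n * card {B. B \<subseteq> {..<u} \<and> real (card B) < ?b})"
    using card_good_le[OF filter r space, of ?b] by (simp only: of_nat_le_iff mem_Collect_eq conj_assoc)
  also have "\<dots> \<le> (2 ^ Suc s)\<^sup>2 * 2 ^ n * (exp (real n) * real (u choose n) powr (eps + 1 / real n))"
    using card_small_subsets_le[of n u "eps + 1 / real n"] eps assms(6,7) nonneg(2) unfolding b
    by (simp add: mult_left_le)
  finally show ?thesis
    using N by linarith
qed

lemma space_lower_bound:
  assumes filter: "dynamic_filter u n pfail eps F"
    and nonneg: "0 \<le> pfail" "0 \<le> eps"
    and prob: "2 powr - real n \<le> 1 / (1 + real n * eps) - 2 * real n * pfail"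
    and eps: "eps \<le> 1 - 1 / real n" and n: "0 < n" "n \<le> u"
    and space: "filter_space u n F = enat s"
  shows "1 / 2 * (1 - eps - 1 / real n) * log 2 (real (u choose n)) - 3 * real n \<le> real s"
proof -
  let ?c = "real (u choose n)" and ?d = "eps + 1 / real n"
  have c: "0 < ?c"
    using n by simp
  \<comment> \<open>Bounding \<open>exp 1\<close> by 4 turns this factor into a power of
    two.\<close>
  have "exp (real n) = exp 1 ^ n"
    by (simp add: exp_of_nat_mult[symmetric])
  also have "\<dots> \<le> 4 ^ n"
    using exp_le by (intro power_mono) auto
  finally have e: "exp (real n) \<le> 2 powr (2 * real n)"
    by (simp add: powr_powr[symmetric] powr_realpow)
  have "2 powr - real n * ?c \<le> (2 ^ Suc s)\<^sup>2 * 2 ^ n * (exp (real n) * ?c powr ?d)"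
    by (rule binomial_le_space[OF assms])
  also have "\<dots> \<le> (2 ^ Suc s)\<^sup>2 * 2 ^ n * (2 powr (2 * real n) * ?c powr ?d)"
    using e by (intro mult_left_mono mult_right_mono) auto
  also have "(2 ^ Suc s)\<^sup>2 * 2 ^ n * (2 powr (2 * real n) * ?c powr ?d) =
      2 powr (2 * real s + 2 + 3 * real n) * ?c powr ?d"
  proof -
    have "(2::real) powr (2 * real s + 2 + 3 * real n) =
        2 powr real (Suc s * 2 + n) * 2 powr (2 * real n)"
      by (simp add: powr_add[symmetric] algebra_simps)
    also have "(2::real) powr real (Suc s * 2 + n) = (2 ^ Suc s)\<^sup>2 * 2 ^ n"
      by (subst powr_realpow) (simp_all only: power_add power_mult zero_less_numeral)
    finally show ?thesis by simp
  qed
  finally have "log 2 (2 powr - real n * ?c) \<le> log 2 (2 powr (2 * real s + 2 + 3 * real n) * ?c powr ?d)"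
    using c by (subst log_le_cancel_iff) auto
  then have "- real n + log 2 ?c \<le> 2 * real s + 2 + 3 * real n + ?d * log 2 ?c"
    using c by (simp add: log_mult log_powr)
  then have "(1 - ?d) * log 2 ?c \<le> 2 * real s + 2 + 4 * real n"
    by (simp add: algebra_simps)
  \<comment> \<open>Halving leaves \<open>s + 1 + 2 * n\<close>, and \<open>1 \<le> n\<close>
    absorbs the 1; this gives the constant 3.\<close>
  moreover have "x / 2 - 3 * real n \<le> real s" if "x \<le> 2 * real s + 2 + 4 * real n" for x
    using that n by simp
  ultimately have "(1 - ?d) * log 2 ?c / 2 - 3 * real n \<le> real s"
    by blast
  moreover have "1 / 2 * (1 - eps - 1 / real n) * log 2 ?c = (1 - ?d) * log 2 ?c / 2"
    by (simp add: diff_diff_eq)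
  ultimately show ?thesis
    by metis
qed

theorem theorem14:
  shows "\<exists>C::real. C > 0 \<and>
    (\<forall>(u::nat) (n::nat) (pfail::real) (eps::real) (F::dfilter).
      u > 0 \<longrightarrow> n > 0 \<longrightarrow> pfail \<ge> 0 \<longrightarrow> eps \<ge> 0 \<longrightarrow>
      dynamic_filter u n pfail eps F \<longrightarrow>
      2 * real n * pfail \<le> 1 / (1 + real n * eps) - 2 powr (- real n) \<longrightarrow>
      eps \<le> 1 - 1 / real n \<longrightarrow>
      u \<ge> 2 * n \<longrightarrow>
      ereal_of_enat (filter_space u n F)
        \<ge> ereal (1 / 2 * (1 - eps - 1 / real n) * log 2 (real (u choose n)) - C * real n))"
proof (intro exI[of _ 3] conjI allI impI)
  fix u n :: nat and pfail eps :: real and F :: dfilter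
  assume "n > 0" "pfail \<ge> 0" "eps \<ge> 0" "dynamic_filter u n pfail eps F"
    "2 * real n * pfail \<le> 1 / (1 + real n * eps) - 2 powr (- real n)"
    "eps \<le> 1 - 1 / real n" "u \<ge> 2 * n"
  then show "ereal_of_enat (filter_space u n F)
      \<ge> ereal (1 / 2 * (1 - eps - 1 / real n) * log 2 (real (u choose n)) - 3 * real n)"
    \<comment> \<open>If the space is infinite, the bound is trivial.\<close>
    using space_lower_bound[of u n pfail eps F] by (cases "filter_space u n F") auto
qed simp

end
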